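(* Let $\{\zeta_k:k\in\mathbb{Z}\}$ be the basic limit functions of a semi-regular subdivision scheme with bi-infinite subdivision matrix $\mathbf{Z}$, and let $\{\varphi_k:k\in\mathbb{Z}\}$ be the basic limit functions of another semi-regular subdivision scheme with bi-infinite subdivision matrix $\mathbf{W}$, both satisfying the properties (i)-(iii) listed in the context. Let $\mathbf{D}=\mathrm{diag}(\mathbf{d})$ with $\mathbf{d}(k)=\int_{\mathbb{R}}\varphi_k(x)\,dx>0$, let $\Phi=\mathbf{D}^{-1/2}[\varphi_k:k\in\mathbb{Z}]$, and let $\mathbf{Q}$ be a bi-infinite matrix such that the column vectors $\Psi_j=[\psi_{j,k}:k\in\mathbb{Z}]$ given by $$\Psi_j=2^{j/2}\,\mathbf{Q}^T\,\Phi(2^j\cdot),\qquad j\in\mathbb{N},$$ together with the entries $\phi_k$ of $\Phi$ form a wavelet tight frame $\mathcal{F}=\{\phi_k:k\in\mathbb{Z}\}\cup\{\psi_{j,k}:j\in\mathbb{N},k\in\mathbb{Z}\}$ satisfying the assumptions (I)-(V) listed in the context for some $s>0$ and $v\in\mathbb{N}$. Then, for every $j\in\mathbb{N}$ and $i,k\in\mathbb{Z}$, one has $\langle\zeta_i,\psi_{j,k}\rangle=\mathbf{C}_j(i,k)$, where $$\mathbf{C}_j=2^{-j/2}\,(\mathbf{Z}^j)^T\,\mathbf{G}\,\mathbf{D}^{-1/2}\,\mathbf{Q},$$ and $\mathbf{G}$ is the cross-Gramian matrix $\mathbf{G}(i,k)=\langle\zeta_i,\varphi_k\rangle$, $i,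k\in\mathbb{Z}$.
   Context: $\mathbb{N}=\{1,2,\dots\}$, $\mathbb{N}_0=\mathbb{N}\cup\{0\}$; functions are real-valued on $\mathbb{R}$ and $\langle f,g\rangle=\int_{\mathbb{R}}f(x)g(x)\,dx$. Bi-infinite matrices and column vectors are real with index set $\mathbb{Z}$; the columns of $\mathbf{Z}$, $\mathbf{W}$ and $\mathbf{Q}$ have only finitely many non-zero entries, so that all products are well defined. The schemes live on the semi-regular mesh $-h_\ell\mathbb{N}\cup\{0\}\cup h_r\mathbb{N}$ with $h_\ell,h_r\in(0,\infty)$. Properties of the basic limit functions (stated for $\zeta_k$ and $\mathbf{Z}$; the same is assumed for $\varphi_k$ and $\mathbf{W}$). The $\zeta_k$ are compactly supported and uniformly continuous, and: (i) $[\zeta_k(x):k\in\mathbb{Z}]=(\mathbf{Z}^j)^T[\zeta_k(2^jx):k\in\mathbb{Z}]$ for all $x\in\mathbb{R}$, $j\in\mathbb{N}$; (ii) $1$ is the unique largest eigenvalue of $\mathbf{Z}$ in absolute value, with eigenvector $\mathbf{1}$ (all entries equal to $1$): $\mathbf{1}=\mathbf{Z}\mathbf{1}$, and $[\zeta_k(2^jx):k\in\mathbb{Z}]^T\mathbf{1}\equiv1$; (iii) there are integers $k_\ell(\mathbf{Z})\le k_r(\mathbf{Z})$ and bi-infinite vectors $\mathbf{z}_\ell,\mathbf{z}_r$ such that, for $x\in\mathbb{R}$ and $i\in\mathbb{Z}$: for $k\le k_\ell(\mathbf{Z})$, $\zeta_k(x)=\zeta_{k_\ell(\mathbf{Z})}(x+h_\ell(k_\ell(\mathbf{Z})-k))$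 and $\mathbf{Z}(i,k)=\mathbf{z}_\ell(i+2(k_\ell(\mathbf{Z})-k))$; for $k\ge k_r(\mathbf{Z})$, $\zeta_k(x)=\zeta_{k_r(\mathbf{Z})}(x+h_r(k_r(\mathbf{Z})-k))$ and $\mathbf{Z}(i,k)=\mathbf{z}_r(i+2(k_r(\mathbf{Z})-k))$. Assumptions on $\mathcal{F}$ (for given $s>0$, $v\in\mathbb{N}$). Here $\mathcal{C}^r(\mathbb{R})$ is the usual space of $r$ times continuously differentiable functions for $r\in\mathbb{N}_0$, and the usual Hölder space for non-integer $r$, with the standard norm $\|\cdot\|_{\mathcal{C}^r}$ (sum of the sup-norms of all derivatives up to order $\lfloor r\rfloor$ plus, for non-integer $r$, the $(r-\lfloor r\rfloor)$-Hölder seminorm of the derivative of order $\lfloor r\rfloor$). (I) $f=\sum_{k}\langle f,\phi_k\rangle\phi_k+\sum_{j\in\mathbb{N}}\sum_{k}\langle f,\psi_{j,k}\rangle\psi_{j,k}$ for all $f\in L^2(\mathbb{R})$. (II) There is $C_{supp}>0$ with $\sup_{k}|\mathrm{supp}(\phi_k)|\le C_{supp}$ and $\sup_k|\mathrm{supp}(\psi_{j,k})|\le C_{supp}2^{-j}$ for all $j\in\mathbb{N}$, where $|\mathrm{supp}(\cdot)|$ is the length of the smallest closed interval containing the support. (III) There is $C_\Gamma>0$ such that for every bounded interval $K\subset\mathbb{R}$ the sets $\Gamma_0(K)=\{k:\mathrm{supp}(\phi_k)\cap K\neq\emptyset\}$ and $\Gamma_j(K)=\{k:\mathrm{supp}(\psi_{j,k})\cap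 K\ne\emptyset\}$, $j\in\mathbb{N}$, satisfy $|\Gamma_j(K)|\le C_\Gamma(2^j|K|+1)$ for all $j\ge0$. (IV) $\int_{\mathbb{R}}x^n\psi_{j,k}(x)\,dx=0$ for $n\in\{0,\dots,v-1\}$, $j\in\mathbb{N}$, $k\in\mathbb{Z}$, and there are points $x_{j,k}\in\mathbb{R}$ such that for every $0\le r\le v$ there is $C_{vm,r}>0$ with $\sup_{k}\int_{\mathbb{R}}|x|^r|\psi_{j,k}(x+x_{j,k})|\,dx\le C_{vm,r}2^{-j(r+\frac12)}$ for all $j\in\mathbb{N}$. (V) $\mathcal{F}\subset\mathcal{C}^s(\mathbb{R})$ and for every $0\le r\le s$ there is $C_{sm,r}>0$ with $\sup_k\|\phi_k\|_{\mathcal{C}^r}\le C_{sm,r}$ and $\sup_k\|\psi_{j,k}\|_{\mathcal{C}^r}\le C_{sm,r}2^{j(r+\frac12)}$ for all $j\in\mathbb{N}$. *)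

theory Defs
  imports "HOL-Analysis.Analysis" "HOL-Library.Groups_Big_Fun"
begin

section \<open>Bi-infinite matrices and vectors\<close>

type_synonym bivec = "int \<Rightarrow> real"
type_synonym bimat = "int \<Rightarrow> int \<Rightarrow> real"

text \<open>
  \<^const>\<open>Sum_any\<close> is the sum over all indices with a non-zero summand; it is \<open>0\<close> if there
  are infinitely many of them.  In all uses below only finitely many summands are non-zero, because
  the matrices involved have finite columns; the rows of the subdivision matrices are finite
  too, by the shift structure in \<open>semiregular_scheme\<close>.
\<close>

definition bi_mult :: "bimat \<Rightarrow> bimat \<Rightarrow> bimat"  (infixl \<open>\<otimes>\<^sub>m\<close> 70) where
  "A \<otimes>\<^sub>m B = (\<lambda>i k. Sum_any (\<lambda>m. A i m * B m k))"

definition bi_mult_vec :: "bimat \<Rightarrow> bivec \<Rightarrow> bivec"  (infixr \<open>\<otimes>\<^sub>v\<close> 70) where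
  "A \<otimes>\<^sub>v x = (\<lambda>i. Sum_any (\<lambda>k. A i k * x k))"

definition bi_dot :: "bivec \<Rightarrow> bivec \<Rightarrow> real" where
  "bi_dot x y = Sum_any (\<lambda>k. x k * y k)"

definition bi_transpose :: "bimat \<Rightarrow> bimat" where
  "bi_transpose A = (\<lambda>i k. A k i)"

definition bi_diag :: "bivec \<Rightarrow> bimat" where
  "bi_diag d = (\<lambda>i k. if i = k then d i else 0)"

fun bi_power :: "bimat \<Rightarrow> nat \<Rightarrow> bimat" where
  "bi_power A 0 = bi_diag (\<lambda>_. 1)"
| "bi_power A (Suc j) = A \<otimes>\<^sub>m bi_power A j"

definition finite_columns :: "bimat \<Rightarrow> bool" where
  "finite_columns A \<longleftrightarrow> (\<forall>k. finite {i. A i k \<noteq> 0})"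

text \<open>Eigenvalues of a real matrix may be complex; eigenvectors are arbitrary non-zero
  sequences, with no growth condition.\<close>

definition bi_eigenvalue :: "bimat \<Rightarrow> complex \<Rightarrow> bool" where
  "bi_eigenvalue A \<mu> \<longleftrightarrow>
    (\<exists>x :: int \<Rightarrow> complex. x \<noteq> (\<lambda>_. 0) \<and>
      (\<forall>i. Sum_any (\<lambda>k. complex_of_real (A i k) * x k) = \<mu> * x i))"


section \<open>Functions on the real line\<close>

definition ip :: "(real \<Rightarrow> real) \<Rightarrow> (real \<Rightarrow> real) \<Rightarrow> real" where
  "ip f g = (LINT x|lebesgue. f x * g x)"

definition supp :: "(real \<Rightarrow> real) \<Rightarrow> real set" where
  "supp f = closure {x. f x \<noteq> 0}"

text \<open>Length (possibly infinite) of the smallest closed interval containing the support.\<close>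

definition supp_length :: "(real \<Rightarrow> real) \<Rightarrow> ennreal" where
  "supp_length f = emeasure lborel ((\<lambda>I. closed I \<and> is_interval I) hull supp f)"

definition L2 :: "(real \<Rightarrow> real) set" where
  "L2 = {f \<in> borel_measurable lebesgue. integrable lebesgue (\<lambda>x. (f x)\<^sup>2)}"

text \<open>Unconditional convergence in \<open>L\<^sup>2(\<real>)\<close> of \<open>u i\<close>, \<open>i \<in> A\<close>, to \<open>g\<close>, expressed through the squared
  \<open>L\<^sup>2\<close>-distance.\<close>

definition L2_has_sum :: "('i \<Rightarrow> real \<Rightarrow> real) \<Rightarrow> (real \<Rightarrow> real) \<Rightarrow> 'i set \<Rightarrow> bool" where
  "L2_has_sum u g A \<longleftrightarrow>
    ((\<lambda>F. \<integral>\<^sup>+x. ennreal ((g x - (\<Sum>i\<in>F. u i x))\<^sup>2) \<partial>lebesgue) \<longlongrightarrow> 0) (finite_subsets_at_top A)"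

definition times_cont_diff :: "nat \<Rightarrow> (real \<Rightarrow> real) \<Rightarrow> bool" where
  "times_cont_diff n f \<longleftrightarrow>
    (\<forall>m<n. \<forall>x. (deriv ^^ m) f differentiable (at x)) \<and>
    (\<forall>m\<le>n. continuous_on UNIV ((deriv ^^ m) f))"

definition hoelder_seminorm :: "real \<Rightarrow> (real \<Rightarrow> real) \<Rightarrow> ennreal" where
  "hoelder_seminorm \<alpha> g = (SUP (x, y) \<in> {(x, y). x \<noteq> y}. ennreal (\<bar>g x - g y\<bar> / \<bar>x - y\<bar> powr \<alpha>))"

definition C_norm :: "real \<Rightarrow> (real \<Rightarrow> real) \<Rightarrow> ennreal" where
  "C_norm r f =
    (\<Sum>n\<le>nat \<lfloor>r\<rfloor>. SUP x. ennreal \<bar>(deriv ^^ n) f x\<bar>) +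
    (if r \<in> \<int> then 0 else hoelder_seminorm (frac r) ((deriv ^^ nat \<lfloor>r\<rfloor>) f))"

definition C_space :: "real \<Rightarrow> (real \<Rightarrow> real) set" where
  "C_space r = {f. times_cont_diff (nat \<lfloor>r\<rfloor>) f \<and> (r \<notin> \<int> \<longrightarrow> C_norm r f < \<infinity>)}"


section \<open>Semi-regular subdivision schemes\<close>

text \<open>\<open>\<zeta> k\<close> are the basic limit functions and \<open>Z\<close> is the subdivision matrix of a scheme on the mesh
  \<open>- h\<^sub>l \<nat> \<union> {0} \<union> h\<^sub>r \<nat>\<close>, both given axiomatically by their properties.\<close>

definition semiregular_scheme ::
  "real \<Rightarrow> real \<Rightarrow> bimat \<Rightarrow> (int \<Rightarrow> real \<Rightarrow> real) \<Rightarrow> bool" where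
  "semiregular_scheme hl hr Z \<zeta> \<longleftrightarrow>
    finite_columns Z \<and>
    (\<forall>k. compact (supp (\<zeta> k)) \<and> uniformly_continuous_on UNIV (\<zeta> k)) \<and>
    (\<forall>j\<ge>1. \<forall>x. (\<lambda>k. \<zeta> k x) = bi_transpose (bi_power Z j) \<otimes>\<^sub>v (\<lambda>k. \<zeta> k (2 ^ j * x))) \<and>
    Z \<otimes>\<^sub>v (\<lambda>_. 1) = (\<lambda>_. 1) \<and>
    (\<forall>\<mu>. bi_eigenvalue Z \<mu> \<longrightarrow> \<mu> \<noteq> 1 \<longrightarrow> cmod \<mu> < 1) \<and>
    (\<forall>j\<ge>1. \<forall>x. bi_dot (\<lambda>k. \<zeta> k (2 ^ j * x)) (\<lambda>_. 1) = 1) \<and>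
    (\<exists>(kl :: int) (kr :: int) (zl :: bivec) (zr :: bivec). kl \<le> kr \<and>
      (\<forall>k\<le>kl. (\<forall>x. \<zeta> k x = \<zeta> kl (x + hl * of_int (kl - k))) \<and>
               (\<forall>i. Z i k = zl (i + 2 * (kl - k)))) \<and>
      (\<forall>k\<ge>kr. (\<forall>x. \<zeta> k x = \<zeta> kr (x + hr * of_int (kr - k))) \<and>
               (\<forall>i. Z i k = zr (i + 2 * (kr - k)))))"


section \<open>Assumptions on the wavelet tight frame\<close>

text \<open>The frame consists of \<open>\<phi> k\<close> and of \<open>\<psi> j k\<close> with \<open>j \<ge> 1\<close>; the values \<open>\<psi> 0 k\<close> are irrelevant.\<close>

definition frame_expansion ::
  "(int \<Rightarrow> real \<Rightarrow> real) \<Rightarrow> (nat \<Rightarrow> int \<Rightarrow> real \<Rightarrow> real) \<Rightarrow> bool" where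
  "frame_expansion \<phi> \<psi> \<longleftrightarrow>
    (\<forall>f\<in>L2. \<exists>g0\<in>L2. \<exists>g. (\<forall>j\<ge>1. g j \<in> L2) \<and>
      L2_has_sum (\<lambda>k x. ip f (\<phi> k) * \<phi> k x) g0 UNIV \<and>
      (\<forall>j\<ge>1. L2_has_sum (\<lambda>k x. ip f (\<psi> j k) * \<psi> j k x) (g j) UNIV) \<and>
      L2_has_sum g (\<lambda>x. f x - g0 x) {1..})"

definition frame_support ::
  "(int \<Rightarrow> real \<Rightarrow> real) \<Rightarrow> (nat \<Rightarrow> int \<Rightarrow> real \<Rightarrow> real) \<Rightarrow> bool" where
  "frame_support \<phi> \<psi> \<longleftrightarrow>
    (\<exists>C>0. (SUP k. supp_length (\<phi> k)) \<le> ennreal C \<and>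
      (\<forall>j\<ge>1. (SUP k. supp_length (\<psi> j k)) \<le> ennreal (C * 2 powr (- real j))))"

definition frame_index_set ::
  "(int \<Rightarrow> real \<Rightarrow> real) \<Rightarrow> (nat \<Rightarrow> int \<Rightarrow> real \<Rightarrow> real) \<Rightarrow> nat \<Rightarrow> real set \<Rightarrow> int set" where
  "frame_index_set \<phi> \<psi> j K =
    (if j = 0 then {k. supp (\<phi> k) \<inter> K \<noteq> {}} else {k. supp (\<psi> j k) \<inter> K \<noteq> {}})"

definition frame_overlap ::
  "(int \<Rightarrow> real \<Rightarrow> real) \<Rightarrow> (nat \<Rightarrow> int \<Rightarrow> real \<Rightarrow> real) \<Rightarrow> bool" where
  "frame_overlap \<phi> \<psi> \<longleftrightarrow>
    (\<exists>C>0. \<forall>K. is_interval K \<and> bounded K \<longrightarrow>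
      (\<forall>j. finite (frame_index_set \<phi> \<psi> j K) \<and>
           real (card (frame_index_set \<phi> \<psi> j K)) \<le> C * (2 ^ j * measure lborel K + 1)))"

text \<open>Below, \<open>\<bar>x\<bar> powr r\<close> deviates from \<open>\<bar>x\<bar>\<^sup>r\<close> only for \<open>x = 0\<close> and \<open>r = 0\<close>, a null set under
  the integral.\<close>

definition frame_vanishing_moments ::
  "nat \<Rightarrow> (nat \<Rightarrow> int \<Rightarrow> real \<Rightarrow> real) \<Rightarrow> bool" where
  "frame_vanishing_moments v \<psi> \<longleftrightarrow>
    (\<forall>n<v. \<forall>j\<ge>1. \<forall>k. has_bochner_integral lebesgue (\<lambda>x. x ^ n * \<psi> j k x) 0) \<and>
    (\<exists>p :: nat \<Rightarrow> int \<Rightarrow> real. \<forall>r. 0 \<le> r \<and> r \<le> real v \<longrightarrow>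
      (\<exists>C>0. \<forall>j\<ge>1.
        (SUP k. \<integral>\<^sup>+x. ennreal (\<bar>x\<bar> powr r * \<bar>\<psi> j k (x + p j k)\<bar>) \<partial>lebesgue)
          \<le> ennreal (C * 2 powr (- (real j * (r + 1 / 2))))))"

definition frame_smoothness ::
  "real \<Rightarrow> (int \<Rightarrow> real \<Rightarrow> real) \<Rightarrow> (nat \<Rightarrow> int \<Rightarrow> real \<Rightarrow> real) \<Rightarrow> bool" where
  "frame_smoothness s \<phi> \<psi> \<longleftrightarrow>
    (\<forall>k. \<phi> k \<in> C_space s) \<and> (\<forall>j\<ge>1. \<forall>k. \<psi> j k \<in> C_space s) \<and>
    (\<forall>r. 0 \<le> r \<and> r \<le> s \<longrightarrow>
      (\<exists>C>0. (SUP k. C_norm r (\<phi> k)) \<le> ennreal C \<and>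
        (\<forall>j\<ge>1. (SUP k. C_norm r (\<psi> j k)) \<le> ennreal (C * 2 powr (real j * (r + 1 / 2))))))"

definition wavelet_tight_frame ::
  "real \<Rightarrow> nat \<Rightarrow> (int \<Rightarrow> real \<Rightarrow> real) \<Rightarrow> (nat \<Rightarrow> int \<Rightarrow> real \<Rightarrow> real) \<Rightarrow> bool" where
  "wavelet_tight_frame s v \<phi> \<psi> \<longleftrightarrow>
    frame_expansion \<phi> \<psi> \<and> frame_support \<phi> \<psi> \<and> frame_overlap \<phi> \<psi> \<and>
    frame_vanishing_moments v \<psi> \<and> frame_smoothness s \<phi> \<psi>"

end

theory Submission
  imports Defs
begin

text \<open>
  Fix \<open>j \<ge> 1\<close>, \<open>i\<close> and \<open>k\<close>. The \<open>j\<close>-fold refinement equation writes \<open>\<zeta> i\<close> as a combination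
  of the dilates \<open>\<zeta> n (2 ^ j * x)\<close> with coefficients from column \<open>i\<close> of \<open>bi_power Z j\<close>
  (\<open>refinement_finite\<close>), while \<open>\<psi> j k\<close> is by definition a combination of the dilates
  \<open>\<phi>0 m (2 ^ j * x)\<close> with coefficients from column \<open>k\<close> of \<open>Q\<close>, rescaled by
  \<open>d m powr (- 1 / 2)\<close>. Both functions therefore live on the same dilated grid, and the substitution
  \<open>y = 2 ^ j * x\<close> turns their inner product into \<open>2 ^ -j\<close> times an inner product of undilated
  functions (\<open>ip_dilate\<close>). Expanding the latter bilinearly produces the cross-Gramian entries
  \<open>ip (\<zeta> n) (\<phi>0 m)\<close> (\<open>ip_sum_sum\<close>). The powers of two combine as
  \<open>2 ^ -j * 2 powr (j / 2) = 2 powr (- j / 2)\<close>.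

  Only two points need care. The sums have to be finite, so that they commute with the integral and
  so that \<^const>\<open>Sum_any\<close> is a genuine sum: this holds because powers of a matrix with finite
  columns have finite columns (\<open>finite_columns_power\<close>). The products have to be integrable,
  for otherwise the integral is not additive: they are continuous with compact support
  (\<open>integrable_mult_compact_supp\<close>).
\<close>

lemma finite_columns_mult:
  assumes "finite_columns A" and "finite_columns B"
  shows "finite_columns (A \<otimes>\<^sub>m B)"
  unfolding finite_columns_def
proof
  fix k
  have "{i. (A \<otimes>\<^sub>m B) i k \<noteq> 0} \<subseteq> (\<Union>m\<in>{m. B m k \<noteq> 0}. {i. A i m \<noteq> 0})"
  proof
    fix i assume "i \<in> {i. (A \<otimes>\<^sub>m B) i k \<noteq> 0}"
    then have "Sum_any (\<lambda>m. A i m * B m k) \<noteq> 0"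
      by (simp add: bi_mult_def)
    then obtain m where "A i m * B m k \<noteq> 0"
      by (rule Sum_any.not_neutral_obtains_not_neutral)
    then show "i \<in> (\<Union>m\<in>{m. B m k \<noteq> 0}. {i. A i m \<noteq> 0})"
      by auto
  qed
  moreover have "finite (\<Union>m\<in>{m. B m k \<noteq> 0}. {i. A i m \<noteq> 0})"
    using assms by (auto simp: finite_columns_def)
  ultimately show "finite {i. (A \<otimes>\<^sub>m B) i k \<noteq> 0}"
    by (rule finite_subset)
qed

lemma finite_columns_power:
  assumes "finite_columns A"
  shows "finite_columns (bi_power A j)"
proof (induction j)
  case 0
  show ?case
    by (simp add: finite_columns_def bi_diag_def)
next
  case (Suc j)
  then show ?case
    by (simp add: finite_columns_mult assms)
qed

text \<open>A finite column of the matrix makes the defining sum of a transposed product finite.\<close>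

lemma transpose_mult_vec_finite:
  assumes "finite_columns A"
  shows "(bi_transpose A \<otimes>\<^sub>v x) k = (\<Sum>m\<in>{m. A m k \<noteq> 0}. A m k * x m)"
  unfolding bi_mult_vec_def bi_transpose_def
  using assms by (intro Sum_any.expand_superset) (auto simp: finite_columns_def)

lemma transpose_mult_finite:
  assumes "finite_columns A"
  shows "(bi_transpose A \<otimes>\<^sub>m B) i k = (\<Sum>n\<in>{n. A n i \<noteq> 0}. A n i * B n k)"
  unfolding bi_mult_def bi_transpose_def
  using assms by (intro Sum_any.expand_superset) (auto simp: finite_columns_def)

lemma mult_finite_columns:
  assumes "finite_columns B"
  shows "(A \<otimes>\<^sub>m B) i k = (\<Sum>m\<in>{m. B m k \<noteq> 0}. A i m * B m k)"
  unfolding bi_mult_def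
  using assms by (intro Sum_any.expand_superset) (auto simp: finite_columns_def)

lemma diag_mult_vec: "(bi_diag d \<otimes>\<^sub>v x) i = d i * x i"
proof -
  have "(bi_diag d \<otimes>\<^sub>v x) i = (\<Sum>k\<in>{i}. bi_diag d i k * x k)"
    unfolding bi_mult_vec_def
    by (rule Sum_any.expand_superset) (auto simp: bi_diag_def)
  then show ?thesis
    by (simp add: bi_diag_def)
qed

lemma mult_diag: "(A \<otimes>\<^sub>m bi_diag d) i k = A i k * d k"
proof -
  have "(A \<otimes>\<^sub>m bi_diag d) i k = (\<Sum>m\<in>{k}. A i m * bi_diag d m k)"
    unfolding bi_mult_def
    by (rule Sum_any.expand_superset) (auto simp: bi_diag_def)
  then show ?thesis
    by (simp add: bi_diag_def)
qed

text \<open>Compact support of one factor suffices: the product is the restriction of a continuous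
  function to that compact set.\<close>

lemma integrable_mult_compact_supp:
  assumes "continuous_on UNIV f" and "continuous_on UNIV g" and "compact (supp f)"
  shows "integrable lborel (\<lambda>x. f x * g x)"
proof -
  have "integrable lborel (\<lambda>x. indicator (supp f) x *\<^sub>R (f x * g x))"
    using assms
    by (intro borel_integrable_compact continuous_on_mult) (auto intro: continuous_on_subset)
  moreover have "f x = 0" if "x \<notin> supp f" for x
    using that closure_subset[of "{x. f x \<noteq> 0}"] by (auto simp: supp_def)
  then have "(\<lambda>x. indicator (supp f) x *\<^sub>R (f x * g x)) = (\<lambda>x. f x * g x)"
    by (auto simp: fun_eq_iff indicator_def)
  ultimately show ?thesis
    by simp
qed

text \<open>For continuous functions the Lebesgue integral is a Borel integral, for which the affine
  substitution rule is available.\<close>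

lemma ip_eq_lborel:
  assumes "continuous_on UNIV f" and "continuous_on UNIV g"
  shows "ip f g = (LINT x|lborel. f x * g x)"
  unfolding ip_def
  using assms
  by (intro integral_completion)
    (auto intro!: borel_measurable_continuous_onI continuous_on_mult)

lemma ip_dilate:
  assumes "continuous_on UNIV f" and "continuous_on UNIV g" and "c > 0"
  shows "ip (\<lambda>x. f (c * x)) (\<lambda>x. g (c * x)) = ip f g / c"
proof -
  have "continuous_on UNIV (\<lambda>x. h (c * x))" if "continuous_on UNIV h" for h :: "real \<Rightarrow> real"
    using that by (rule continuous_on_compose2) (intro continuous_intros, simp)
  then have "ip (\<lambda>x. f (c * x)) (\<lambda>x. g (c * x)) = (LINT x|lborel. f (c * x) * g (c * x))"
    using assms by (intro ip_eq_lborel) auto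
  moreover have "ip f g = c * (LINT x|lborel. f (c * x) * g (c * x))"
    using lborel_integral_real_affine[of c "\<lambda>x. f x * g x" 0] assms
    by (simp add: ip_eq_lborel)
  ultimately show ?thesis
    using \<open>c > 0\<close> by simp
qed

text \<open>The outer sum runs over the second family, as in a left-associated matrix product, where the
  last factor is summed last.\<close>

lemma ip_sum_sum:
  assumes f: "\<And>n. n \<in> A \<Longrightarrow> continuous_on UNIV (f n)" "\<And>n. n \<in> A \<Longrightarrow> compact (supp (f n))"
    and g: "\<And>m. m \<in> B \<Longrightarrow> continuous_on UNIV (g m)"
  shows "ip (\<lambda>x. \<Sum>n\<in>A. a n * f n x) (\<lambda>x. \<Sum>m\<in>B. b m * g m x)
    = (\<Sum>m\<in>B. \<Sum>n\<in>A. a n * b m * ip (f n) (g m))"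
proof -
  have int: "integrable lborel (\<lambda>x. f n x * g m x)" if "n \<in> A" "m \<in> B" for n m
    using that f g by (intro integrable_mult_compact_supp) auto
  have "ip (\<lambda>x. \<Sum>n\<in>A. a n * f n x) (\<lambda>x. \<Sum>m\<in>B. b m * g m x)
      = (LINT x|lborel. (\<Sum>n\<in>A. a n * f n x) * (\<Sum>m\<in>B. b m * g m x))"
    using f g by (intro ip_eq_lborel continuous_intros) auto
  also have "\<dots> = (LINT x|lborel. (\<Sum>m\<in>B. \<Sum>n\<in>A. a n * b m * (f n x * g m x)))"
    by (subst mult.commute, subst sum_product) (simp only: mult_ac)
  also have "\<dots> = (\<Sum>m\<in>B. \<Sum>n\<in>A. a n * b m * (LINT x|lborel. f n x * g m x))"
    using int by simp
  also have "\<dots> = (\<Sum>m\<in>B. \<Sum>n\<in>A. a n * b m * ip (f n) (g m))"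
    using f g by (intro sum.cong refl) (simp add: ip_eq_lborel)
  finally show ?thesis .
qed

lemma semiregular_scheme_continuous:
  assumes "semiregular_scheme hl hr Z \<zeta>"
  shows "continuous_on UNIV (\<zeta> k)"
  using assms by (auto simp: semiregular_scheme_def intro: uniformly_continuous_imp_continuous)

lemma refinement_finite:
  assumes "semiregular_scheme hl hr Z \<zeta>" and "j \<ge> 1"
  shows "\<zeta> i x = (\<Sum>n\<in>{n. bi_power Z j n i \<noteq> 0}. bi_power Z j n i * \<zeta> n (2 ^ j * x))"
proof -
  have "finite_columns (bi_power Z j)"
    using assms by (auto simp: semiregular_scheme_def intro: finite_columns_power)
  moreover have "(\<lambda>k. \<zeta> k x) = bi_transpose (bi_power Z j) \<otimes>\<^sub>v (\<lambda>k. \<zeta> k (2 ^ j * x))"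
    using assms unfolding semiregular_scheme_def by blast
  then have "\<zeta> i x = (bi_transpose (bi_power Z j) \<otimes>\<^sub>v (\<lambda>k. \<zeta> k (2 ^ j * x))) i"
    by (rule fun_cong)
  ultimately show ?thesis
    by (simp only: transpose_mult_vec_finite)
qed

theorem proposition4p3:
  fixes hl hr s :: real and v :: nat
    and \<zeta> \<phi>0 \<Phi> :: "int \<Rightarrow> real \<Rightarrow> real"
    and \<psi> :: "nat \<Rightarrow> int \<Rightarrow> real \<Rightarrow> real"
    and Z W Q G D_inv_sqrt :: bimat and d :: bivec
    and C :: "nat \<Rightarrow> bimat"
  assumes "hl > 0" and "hr > 0" and "s > 0" and "v \<ge> 1"
    and "semiregular_scheme hl hr Z \<zeta>"
    and "semiregular_scheme hl hr W \<phi>0"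
    and "\<And>k. d k = (LINT x|lebesgue. \<phi>0 k x)"
    and "\<And>k. d k > 0"
    and "D_inv_sqrt = bi_diag (\<lambda>k. d k powr (- 1 / 2))"
    and "\<And>x. (\<lambda>k. \<Phi> k x) = D_inv_sqrt \<otimes>\<^sub>v (\<lambda>k. \<phi>0 k x)"
    and "finite_columns Q"
    and "\<And>j x. j \<ge> 1 \<Longrightarrow>
      (\<lambda>k. \<psi> j k x) = (\<lambda>k. 2 powr (real j / 2) * (bi_transpose Q \<otimes>\<^sub>v (\<lambda>m. \<Phi> m (2 ^ j * x))) k)"
    and "wavelet_tight_frame s v \<Phi> \<psi>"
    and "G = (\<lambda>i k. ip (\<zeta> i) (\<phi>0 k))"
    and "\<And>j. C j = (\<lambda>i k. 2 powr (- real j / 2) *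
      (bi_transpose (bi_power Z j) \<otimes>\<^sub>m G \<otimes>\<^sub>m D_inv_sqrt \<otimes>\<^sub>m Q) i k)"
  shows "\<forall>j\<ge>1. \<forall>i k. ip (\<zeta> i) (\<psi> j k) = C j i k"
proof (intro allI impI)
  fix j :: nat and i k :: int
  assume j: "j \<ge> 1"
  define c :: real where "c = 2 ^ j"
  define w where "w m = d m powr (- 1 / 2)" for m
  define P where "P = bi_power Z j"
  define A where "A = {n. P n i \<noteq> 0}"
  define B where "B = {m. Q m k \<noteq> 0}"
  define f where "f y = (\<Sum>n\<in>A. P n i * \<zeta> n y)" for y
  define g where "g y = (\<Sum>m\<in>B. (Q m k * w m) * \<phi>0 m y)" for y
  have "c > 0"
    by (simp add: c_def)
  have scale: "2 powr (real j / 2) / c = 2 powr (- real j / 2)"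
  proof -
    have "c = 2 powr real j"
      by (simp add: c_def powr_realpow)
    then have "2 powr (real j / 2) / c = 2 powr (real j / 2 - real j)"
      by (simp only: powr_diff)
    then show ?thesis
      by simp
  qed
  have P_fin: "finite_columns P"
    using assms(5) by (auto simp: P_def semiregular_scheme_def intro: finite_columns_power)
  have \<zeta>_cont: "continuous_on UNIV (\<zeta> n)" for n
    using assms(5) by (rule semiregular_scheme_continuous)
  have \<phi>_cont: "continuous_on UNIV (\<phi>0 m)" for m
    using assms(6) by (rule semiregular_scheme_continuous)
  have \<zeta>_supp: "compact (supp (\<zeta> n))" for n
    using assms(5) by (simp add: semiregular_scheme_def)
  have f_cont: "continuous_on UNIV f" and g_cont: "continuous_on UNIV g"
    unfolding f_def g_def by (intro continuous_intros \<zeta>_cont \<phi>_cont)+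
  have \<Phi>_eq: "\<Phi> m x = w m * \<phi>0 m x" for m x
    using fun_cong[OF assms(10), of m x] by (simp add: assms(9) diag_mult_vec w_def)

  have \<zeta>_eq: "\<zeta> i = (\<lambda>x. f (c * x))"
    unfolding f_def A_def P_def c_def by (intro ext refinement_finite[OF assms(5) j])
  have \<psi>_eq: "\<psi> j k = (\<lambda>x. 2 powr (real j / 2) * g (c * x))"
  proof
    fix x
    show "\<psi> j k x = 2 powr (real j / 2) * g (c * x)"
      using fun_cong[OF assms(12)[OF j], of k x]
      by (simp add: transpose_mult_vec_finite[OF assms(11)] \<Phi>_eq g_def B_def c_def mult_ac)
  qed
  have "ip (\<zeta> i) (\<psi> j k) = 2 powr (real j / 2) * ip (\<lambda>x. f (c * x)) (\<lambda>x. g (c * x))"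
    by (simp add: \<zeta>_eq \<psi>_eq ip_def mult.left_commute[of _ "2 powr (real j / 2)"])
  also have "\<dots> = 2 powr (- real j / 2) * ip f g"
    unfolding ip_dilate[OF f_cont g_cont \<open>c > 0\<close>] scale[symmetric] by simp
  also have "ip f g = (\<Sum>m\<in>B. \<Sum>n\<in>A. P n i * (Q m k * w m) * ip (\<zeta> n) (\<phi>0 m))"
    unfolding f_def g_def by (intro ip_sum_sum \<zeta>_cont \<zeta>_supp \<phi>_cont)
  also have "\<dots> = (bi_transpose P \<otimes>\<^sub>m G \<otimes>\<^sub>m D_inv_sqrt \<otimes>\<^sub>m Q) i k"
    unfolding mult_finite_columns[OF assms(11)] assms(9) mult_diag
      transpose_mult_finite[OF P_fin] assms(14) A_def B_def w_def sum_distrib_right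
    by (intro sum.cong refl) (simp only: mult_ac)
  finally show "ip (\<zeta> i) (\<psi> j k) = C j i k"
    by (simp add: assms(15) P_def)
qed

end
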